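(* Let $\alpha_+,\beta_+,\alpha_-,\beta_->0$, let $G_+\sim\operatorname{Gamma}(\alpha_+,\beta_+)$ and $G_-\sim\operatorname{Gamma}(\alpha_-,\beta_-)$ be independent (shape–scale convention, so $\mathbb{E}G_\pm=\alpha_\pm\beta_\pm$), and let $$X=(G_+-\alpha_+\beta_+)-(G_--\alpha_-\beta_-).$$ Then $$c_+(X)=\beta_+,\qquad c_-(X)=\beta_-.$$ Both values are controlled by the corresponding moment generating function boundary, i.e. $c_+(X)=1/\tau_+(X)=\lim_{t\uparrow\tau_+(X)}\Psi_+(t)$ and $c_-(X)=1/\tau_-(X)=\lim_{t\uparrow\tau_-(X)}\Psi_-(t)$.
   Context: Let $V=\operatorname{Var}(X)$ and $K_X(t)=\log\mathbb{E}e^{tX}\in[0,\infty]$. Define $c_+(X)$ as the infimum of all $c\ge0$ such that $K_X(t)\le\frac{Vt^2}{2(1-ct)}$ for every $0\le t<1/c$ (with $1/0=\infty$ and $\inf\emptyset=\infty$), and $c_-(X)=c_+(-X)$. Define $\tau_+(X)=\sup\{t>0:K_X(t)<\infty\}$ and $\tau_-(X)=\tau_+(-X)$. For $t\neq 0$ put $M(t)=\frac{2K_X(t)}{Vt^2}$ (this is the moment generating function of the signed canonical remainder of $X$), and for $t>0$ put $\Psi_+(t)=\frac{1-M(t)^{-1}}{t}$, $\Psi_-(t)=\frac{1-M(-t)^{-1}}{t}$ (with $1/\infty=0$). One has $c_\pm(X)=\max\{0,\sup_{t>0}\Psi_\pm(t)\}$; the scale is called boundary controlled when this supremum is given by the limit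 of $\Psi_\pm$ at the moment generating function boundary $\tau_\pm(X)$. *)

theory Defs
  imports "HOL-Probability.Probability"
begin

text \<open>Density of the Gamma law with shape \<open>a\<close> and scale \<open>b\<close> (mean \<open>a * b\<close>).\<close>

definition gamma_density :: "real \<Rightarrow> real \<Rightarrow> real \<Rightarrow> real" where
  "gamma_density a b x =
     (if x \<le> 0 then 0 else x powr (a - 1) * exp (- x / b) / (Gamma a * b powr a))"

text \<open>
  The expectation is a nonnegative integral, so that a divergent one has value \<open>\<infinity>\<close>;
  \<open>log \<infinity> = \<infinity>\<close>, and on a probability space the expectation is never \<open>0\<close>.
\<close>

definition cgf :: "'a measure \<Rightarrow> ('a \<Rightarrow> real) \<Rightarrow> real \<Rightarrow> ereal" where
  "cgf M X t =
     (let m = (\<integral>\<^sup>+ \<omega>. ennreal (exp (t * X \<omega>)) \<partial>M)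
      in if m = \<infinity> then \<infinity> else ereal (ln (enn2real m)))"

text \<open>In \<open>ereal\<close>, \<open>1 / 0 = \<infinity>\<close> and the infimum of the empty set is \<open>\<infinity>\<close>.\<close>

definition c_plus :: "'a measure \<Rightarrow> ('a \<Rightarrow> real) \<Rightarrow> ereal" where
  "c_plus M X = Inf (ereal ` {c. 0 \<le> c \<and>
     (\<forall>t. 0 \<le> t \<and> ereal t < 1 / ereal c \<longrightarrow>
        cgf M X t \<le> ereal (prob_space.variance M X * t\<^sup>2 / (2 * (1 - c * t))))})"

definition c_minus :: "'a measure \<Rightarrow> ('a \<Rightarrow> real) \<Rightarrow> ereal" where
  "c_minus M X = c_plus M (\<lambda>\<omega>. - X \<omega>)"

text \<open>
  The supremum is taken in \<open>[0, \<infinity>]\<close>: inserting \<open>0\<close> only matters for the empty set, whose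
  supremum in \<open>ereal\<close> would be \<open>- \<infinity>\<close>.
\<close>

definition tau_plus :: "'a measure \<Rightarrow> ('a \<Rightarrow> real) \<Rightarrow> ereal" where
  "tau_plus M X = Sup (insert 0 (ereal ` {t. 0 < t \<and> cgf M X t < \<infinity>}))"

definition tau_minus :: "'a measure \<Rightarrow> ('a \<Rightarrow> real) \<Rightarrow> ereal" where
  "tau_minus M X = tau_plus M (\<lambda>\<omega>. - X \<omega>)"

text \<open>Moment generating function of the signed canonical remainder, for \<open>t \<noteq> 0\<close>.\<close>

definition remainder_mgf :: "'a measure \<Rightarrow> ('a \<Rightarrow> real) \<Rightarrow> real \<Rightarrow> ereal" where
  "remainder_mgf M X t = 2 * cgf M X t / ereal (prob_space.variance M X * t\<^sup>2)"

text \<open>Only meant for \<open>t > 0\<close>; in \<open>ereal\<close>, \<open>inverse \<infinity> = 0\<close>.\<close>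

definition Psi_plus :: "'a measure \<Rightarrow> ('a \<Rightarrow> real) \<Rightarrow> real \<Rightarrow> ereal" where
  "Psi_plus M X t = (1 - inverse (remainder_mgf M X t)) / ereal t"

definition Psi_minus :: "'a measure \<Rightarrow> ('a \<Rightarrow> real) \<Rightarrow> real \<Rightarrow> ereal" where
  "Psi_minus M X t = (1 - inverse (remainder_mgf M X (- t))) / ereal t"

text \<open>
  The filter of real \<open>t\<close> increasing strictly to an extended real limit \<open>T\<close>: it is
  \<open>at_left r\<close> for \<open>T = ereal r\<close> and \<open>at_top\<close> for \<open>T = \<infinity>\<close>.
\<close>

definition increasing_to :: "ereal \<Rightarrow> real filter" where
  "increasing_to T = filtercomap ereal (at_left T)"

lemma filtercomap_ereal_filtermap: "filtercomap ereal (filtermap ereal F) = F"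
proof -
  have "eventually P (filtercomap ereal (filtermap ereal F)) = eventually P F" for P
  proof
    assume "eventually P (filtercomap ereal (filtermap ereal F))"
    then obtain Q where "eventually (\<lambda>x. Q (ereal x)) F" and Q: "\<And>x. Q (ereal x) \<Longrightarrow> P x"
      by (auto simp: eventually_filtercomap eventually_filtermap)
    then show "eventually P F" by (auto elim: eventually_mono)
  next
    assume P: "eventually P F"
    show "eventually P (filtercomap ereal (filtermap ereal F))"
      unfolding eventually_filtercomap eventually_filtermap
      by (rule exI[of _ "\<lambda>y. P (real_of_ereal y)"]) (use P in simp)
  qed
  then show ?thesis by (simp add: filter_eq_iff)
qed

lemma increasing_to_ereal: "increasing_to (ereal r) = at_left r"
  by (simp add: increasing_to_def at_left_ereal filtercomap_ereal_filtermap)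

lemma increasing_to_PInfty: "increasing_to \<infinity> = at_top"
  by (simp add: increasing_to_def at_left_PInf filtercomap_ereal_filtermap)

end

theory Submission
  imports Defs
begin

text \<open>
  For \<open>0 \<le> t\<close> and \<open>\<beta>\<^sub>+ t < 1\<close> the cumulant generating function is
  \<open>\<alpha>\<^sub>+ (- log (1 - \<beta>\<^sub>+ t) - \<beta>\<^sub>+ t) + \<alpha>\<^sub>- (\<beta>\<^sub>- t - log (1 + \<beta>\<^sub>- t))\<close>, and it is \<open>\<infinity>\<close> for
  \<open>\<beta>\<^sub>+ t \<ge> 1\<close>. The elementary bounds \<open>- log (1 - x) - x \<le> x\<^sup>2 / (2 (1 - x))\<close> and
  \<open>y - log (1 + y) \<le> y\<^sup>2 / 2\<close> show that \<open>\<beta>\<^sub>+\<close> is an admissible scale, while a smaller \<open>c\<close> would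
  force finiteness at \<open>t = 1 / \<beta>\<^sub>+\<close>. Since the cumulant generating function tends to \<open>\<infinity>\<close> at
  that boundary, \<open>\<Psi>\<^sub>+\<close> tends to \<open>\<beta>\<^sub>+\<close> there. Replacing \<open>X\<close> by \<open>- X\<close> exchanges the two sides.
\<close>

section \<open>Gamma densities and their exponential integrals\<close>

lemma gamma_density_nonneg: "a > 0 \<Longrightarrow> 0 \<le> gamma_density a b x"
  by (simp add: gamma_density_def Gamma_real_pos less_imp_le)

lemma borel_measurable_gamma_density [measurable]:
  "gamma_density a b \<in> borel_measurable borel"
  unfolding gamma_density_def[abs_def] by measurable

text \<open>Rescaling the variable by \<open>b\<close> turns the integral into Euler's integral for
  \<open>Gamma a\<close>.\<close>

lemma nn_integral_gamma_density:
  assumes a: "a > 0" and b: "b > 0"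
  shows "(\<integral>\<^sup>+x. ennreal (gamma_density a b x) \<partial>lborel) = 1"
proof -
  have scale: "\<bar>b\<bar> * gamma_density a b (0 + b * x)
      = inverse (Gamma a) * (indicator {0..} x * x powr (a - 1) / exp x)" for x
  proof (cases "x > 0")
    case True
    have "b powr a = b * b powr (a - 1)"
      using powr_add[of b 1 "a - 1"] b by simp
    with True a b show ?thesis
      by (simp add: gamma_density_def powr_mult exp_minus field_simps zero_less_mult_iff
          mult_le_0_iff indicator_def)
  next
    case False
    with b show ?thesis
      by (auto simp: gamma_density_def indicator_def mult_le_0_iff)
  qed
  have "(\<integral>\<^sup>+x. ennreal (gamma_density a b x) \<partial>lborel)
      = ennreal \<bar>b\<bar> * (\<integral>\<^sup>+x. ennreal (gamma_density a b (0 + b * x)) \<partial>lborel)"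
    by (rule nn_integral_real_affine) (use b in auto)
  also have "\<dots> = (\<integral>\<^sup>+x. ennreal (\<bar>b\<bar> * gamma_density a b (0 + b * x)) \<partial>lborel)"
    by (subst nn_integral_cmult[symmetric]) (auto simp: ennreal_mult')
  also have "\<dots> = (\<integral>\<^sup>+x. ennreal (inverse (Gamma a))
      * ennreal (indicator {0..} x * x powr (a - 1) / exp x) \<partial>lborel)"
    unfolding scale using a by (subst ennreal_mult') (simp_all add: Gamma_real_pos less_imp_le)
  also have "\<dots> = ennreal (inverse (Gamma a)) * ennreal (Gamma a)"
    by (subst nn_integral_cmult) (auto simp: Gamma_conv_nn_integral_real[OF a])
  also have "\<dots> = 1"
    using Gamma_real_pos[OF a] by (simp add: ennreal_mult'[symmetric])
  finally show ?thesis .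
qed

text \<open>Exponential tilting stays within the Gamma family: the rate \<open>1 / b\<close> drops
  to \<open>1 / b - t\<close>, and the normalising constants differ by the displayed power. That
  power is therefore the moment generating function.\<close>

lemma exp_mult_gamma_density:
  assumes "b > 0" "b * t < 1"
  shows "exp (t * x) * gamma_density a b x
    = (1 - b * t) powr (- a) * gamma_density a (b / (1 - b * t)) x"
proof -
  have "exp (t * x) * exp (- x / b) = exp (- x / (b / (1 - b * t)))"
    using assms by (simp add: exp_add[symmetric] field_simps)
  moreover have "(b / (1 - b * t)) powr a = b powr a * (1 - b * t) powr (- a)"
    using assms by (simp add: powr_divide powr_minus_divide)
  ultimately show ?thesis
    using assms by (auto simp: gamma_density_def field_simps)
qed

text \<open>Size biasing raises the shape by one because \<open>Gamma (a + 1) = a * Gamma a\<close>.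
  Moments then follow from the total mass of densities of higher shape.\<close>

lemma mult_gamma_density:
  assumes "a > 0" "b > 0"
  shows "x * gamma_density a b x = a * b * gamma_density (a + 1) b x"
proof (cases "x > 0")
  case True
  have "x * x powr (a - 1) = x powr a"
    using powr_add[of x 1 "a - 1"] True by simp
  moreover have "b powr (a + 1) = b * b powr a"
    using assms by (simp add: powr_add)
  moreover have "Gamma (a + 1) = a * Gamma a"
    using assms Gamma_plus1[of a] nonpos_Ints_nonpos[of a] by fastforce
  ultimately show ?thesis
    using True assms by (simp add: gamma_density_def mult.assoc[symmetric])
qed (simp add: gamma_density_def)

lemma nn_integral_exp_gamma:
  assumes "a > 0" "b > 0" "b * t < 1"
    and D: "distributed M lborel G (\<lambda>x. ennreal (gamma_density a b x))"
  shows "(\<integral>\<^sup>+\<omega>. ennreal (exp (t * G \<omega>)) \<partial>M) = ennreal ((1 - b * t) powr (- a))"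
proof -
  have "(\<integral>\<^sup>+\<omega>. ennreal (exp (t * G \<omega>)) \<partial>M)
      = (\<integral>\<^sup>+x. ennreal (gamma_density a b x) * ennreal (exp (t * x)) \<partial>lborel)"
    by (rule distributed_nn_integral[OF D, symmetric]) auto
  also have "\<dots> = (\<integral>\<^sup>+x. ennreal ((1 - b * t) powr (- a))
      * ennreal (gamma_density a (b / (1 - b * t)) x) \<partial>lborel)"
    using assms by (intro nn_integral_cong)
      (simp add: ennreal_mult''[symmetric] ennreal_mult'[symmetric] gamma_density_nonneg
        exp_mult_gamma_density[symmetric] mult.commute)
  also have "\<dots> = ennreal ((1 - b * t) powr (- a))"
    using assms by (subst nn_integral_cmult) (auto simp: nn_integral_gamma_density)
  finally show ?thesis .
qed

text \<open>Beyond the boundary, compare with the values \<open>(1 - b * s) powr (- a)\<close> for \<open>b * s < 1\<close>.\<close>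

lemma nn_integral_exp_gamma_eq_top:
  assumes a: "a > 0" and b: "b > 0" and t: "b * t \<ge> 1"
    and D: "distributed M lborel G (\<lambda>x. ennreal (gamma_density a b x))"
  shows "(\<integral>\<^sup>+\<omega>. ennreal (exp (t * G \<omega>)) \<partial>M) = \<infinity>"
proof -
  have mono: "(\<integral>\<^sup>+\<omega>. ennreal (exp (s * G \<omega>)) \<partial>M) \<le> (\<integral>\<^sup>+\<omega>. ennreal (exp (t * G \<omega>)) \<partial>M)"
    if "s \<le> t" for s
  proof -
    have "(\<integral>\<^sup>+x. ennreal (gamma_density a b x) * ennreal (exp (s * x)) \<partial>lborel)
      \<le> (\<integral>\<^sup>+x. ennreal (gamma_density a b x) * ennreal (exp (t * x)) \<partial>lborel)"
    \<comment> \<open>The exponentials are ordered only for positive \<open>x\<close>; elsewhere the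
      density vanishes.\<close>
    proof (rule nn_integral_mono)
      fix x
      show "ennreal (gamma_density a b x) * ennreal (exp (s * x))
          \<le> ennreal (gamma_density a b x) * ennreal (exp (t * x))"
        using that by (cases "x > 0")
          (auto intro!: mult_left_mono ennreal_leI simp: gamma_density_def)
    qed
    then show ?thesis
      by (subst (asm) (1 2) distributed_nn_integral[OF D]) auto
  qed
  have large: "ennreal B \<le> (\<integral>\<^sup>+\<omega>. ennreal (exp (t * G \<omega>)) \<partial>M)" if "B > 0" for B
  proof -
    \<comment> \<open>The point \<open>s = (1 - y) / b\<close> satisfies
      \<open>1 - b * s = y\<close>, so \<open>y\<close> is chosen to make the moment generating
      function at \<open>s\<close> equal to \<open>B\<close>. This \<open>s\<close> may be negative,
      which \<open>mono\<close> permits.\<close>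
    define y where "y = B powr (- 1 / a)"
    have y: "y > 0" "y powr (- a) = B"
      using that a by (auto simp: y_def powr_powr)
    have "(1 - y) / b \<le> t"
      using t b y by (simp add: field_simps)
    from mono[OF this] show ?thesis
      using nn_integral_exp_gamma[OF a b _ D, of "(1 - y) / b"] y b by simp
  qed
  show ?thesis
  proof (cases "\<integral>\<^sup>+\<omega>. ennreal (exp (t * G \<omega>)) \<partial>M")
    case (real r)
    with large[of "r + 1"] show ?thesis by simp
  qed simp
qed

section \<open>Independence and second moments\<close>

lemma (in prob_space) indep_var_commute:
  assumes "indep_var S X T Y"
  shows "indep_var T Y S X"
  using assms unfolding indep_var_eq indep_sets2_eq
  by (clarsimp, subst Int_commute, subst mult.commute) auto

text \<open>Working in \<open>ennreal\<close> covers infinite factors, which occur at and beyond the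
  boundary of the moment generating function.\<close>

lemma (in prob_space) indep_var_nn_integral:
  fixes X Y :: "'a \<Rightarrow> ennreal"
  assumes "indep_var borel X borel Y"
  shows "(\<integral>\<^sup>+\<omega>. X \<omega> * Y \<omega> \<partial>M) = (\<integral>\<^sup>+\<omega>. X \<omega> \<partial>M) * (\<integral>\<^sup>+\<omega>. Y \<omega> \<partial>M)"
proof -
  have "indep_vars (\<lambda>_. borel) (case_bool X Y) UNIV"
    using assms by (simp add: indep_var_def case_bool_if cong: if_cong)
  from indep_vars_nn_integral[OF _ this] show ?thesis
    by (simp add: UNIV_bool mult.commute)
qed

text \<open>Size biasing once and twice gives the raw moments \<open>a * b\<close> and
  \<open>a * (a + 1) * b\<^sup>2\<close>; subtracting the squared mean from the latter leaves
  \<open>a * b\<^sup>2\<close>.\<close>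

lemma (in prob_space) gamma_centered:
  fixes G :: "'a \<Rightarrow> real"
  assumes a: "a > 0" and b: "b > 0"
    and D: "distributed M lborel G (\<lambda>x. ennreal (gamma_density a b x))"
  shows "integrable M (\<lambda>\<omega>. G \<omega> - a * b)" "expectation (\<lambda>\<omega>. G \<omega> - a * b) = 0"
    "integrable M (\<lambda>\<omega>. (G \<omega> - a * b)\<^sup>2)" "expectation (\<lambda>\<omega>. (G \<omega> - a * b)\<^sup>2) = a * b\<^sup>2"
proof -
  have unit: "has_bochner_integral lborel (gamma_density c b) 1" if "c > 0" for c
    using nn_integral_gamma_density[OF that b] gamma_density_nonneg[OF that]
    by (intro has_bochner_integral_nn_integral) auto
  have x1: "gamma_density a b x * x = a * b * gamma_density (a + 1) b x" for x
    using mult_gamma_density[OF a b, of x] by (simp add: mult.commute)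
  have x2: "gamma_density a b x * x\<^sup>2 = a * (a + 1) * b\<^sup>2 * gamma_density (a + 1 + 1) b x" for x
    using mult_gamma_density[of "a + 1" b x] x1[of x] a b
    by (simp add: power2_eq_square mult.assoc[symmetric]) (simp add: algebra_simps)
  have 1: "has_bochner_integral lborel (\<lambda>x. gamma_density a b x * x) (a * b)"
    unfolding x1 using has_bochner_integral_mult_right[OF unit[of "a + 1"], of "a * b"] a by simp
  have 2: "has_bochner_integral lborel (\<lambda>x. gamma_density a b x * x\<^sup>2) (a * (a + 1) * b\<^sup>2)"
    unfolding x2
    using has_bochner_integral_mult_right[OF unit[of "a + 1 + 1"], of "a * (a + 1) * b\<^sup>2"] a by simp
  have tr: "has_bochner_integral M (\<lambda>\<omega>. g (G \<omega>)) r"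
    if "has_bochner_integral lborel (\<lambda>x. gamma_density a b x * g x) r"
      and "g \<in> borel_measurable borel" for g :: "real \<Rightarrow> real" and r
    using that distributed_integrable[OF D, of g] distributed_integral[OF D, of g]
      gamma_density_nonneg[OF a]
    by (auto simp: has_bochner_integral_iff)
  have m1: "has_bochner_integral M G (a * b)" and m2: "has_bochner_integral M (\<lambda>\<omega>. (G \<omega>)\<^sup>2) (a * (a + 1) * b\<^sup>2)"
    using tr[OF 1] tr[OF 2] by auto
  note [simp] = m1[THEN has_bochner_integral_integral_eq] m2[THEN has_bochner_integral_integral_eq]
    m1[THEN integrable.intros] m2[THEN integrable.intros]
  show "integrable M (\<lambda>\<omega>. G \<omega> - a * b)" "expectation (\<lambda>\<omega>. G \<omega> - a * b) = 0"
    by (auto simp: prob_space)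
  have sq: "(G \<omega> - a * b)\<^sup>2 = (G \<omega>)\<^sup>2 - 2 * (a * b) * G \<omega> + (a * b)\<^sup>2" for \<omega>
    by (simp add: power2_diff)
  show "integrable M (\<lambda>\<omega>. (G \<omega> - a * b)\<^sup>2)" "expectation (\<lambda>\<omega>. (G \<omega> - a * b)\<^sup>2) = a * b\<^sup>2"
    unfolding sq by (auto simp: prob_space) (simp add: power2_eq_square algebra_simps)
qed

text \<open>The cross term vanishes, since independence factors it into a product of zero
  means.\<close>

lemma (in prob_space) variance_diff_indep_centered:
  fixes U W :: "'a \<Rightarrow> real"
  assumes "indep_var borel U borel W"
    and [simp]: "integrable M U" "integrable M W"
    and EU: "expectation U = 0" and EW: "expectation W = 0"
    and [simp]: "integrable M (\<lambda>\<omega>. (U \<omega>)\<^sup>2)" "integrable M (\<lambda>\<omega>. (W \<omega>)\<^sup>2)"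
  shows "variance (\<lambda>\<omega>. U \<omega> - W \<omega>) = expectation (\<lambda>\<omega>. (U \<omega>)\<^sup>2) + expectation (\<lambda>\<omega>. (W \<omega>)\<^sup>2)"
proof -
  have [simp]: "integrable M (\<lambda>\<omega>. U \<omega> * W \<omega>)" "expectation (\<lambda>\<omega>. U \<omega> * W \<omega>) = 0"
    using indep_var_integrable[OF assms(1)] indep_var_lebesgue_integral[OF assms(1)] EU
    by auto
  have "variance (\<lambda>\<omega>. U \<omega> - W \<omega>) = expectation (\<lambda>\<omega>. (U \<omega>)\<^sup>2 - 2 * (U \<omega> * W \<omega>) + (W \<omega>)\<^sup>2)"
    using EU EW by (simp add: power2_diff algebra_simps)
  then show ?thesis by simp
qed

section \<open>Elementary logarithm bounds\<close>

text \<open>Right side minus left side is \<open>0\<close> at the origin and has derivative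
  \<open>y\<^sup>2 / (2 * (1 - y)\<^sup>2)\<close>.\<close>

lemma minus_ln_one_minus_le:
  fixes x :: real
  assumes "0 \<le> x" "x < 1"
  shows "- ln (1 - x) - x \<le> x\<^sup>2 / (2 * (1 - x))"
proof -
  let ?h = "\<lambda>x::real. x\<^sup>2 / (2 * (1 - x)) + x + ln (1 - x)"
  have "?h 0 \<le> ?h x"
  proof (rule DERIV_nonneg_imp_nondecreasing[OF assms(1)])
    fix y assume y: "0 \<le> y" "y \<le> x"
    with assms have "y < 1" by simp
    then have "(?h has_real_derivative y\<^sup>2 / (2 * (1 - y)\<^sup>2)) (at y)"
      by (auto intro!: derivative_eq_intros) (auto simp: divide_simps, algebra)
    then show "\<exists>d. (?h has_real_derivative d) (at y) \<and> 0 \<le> d"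
      by fastforce
  qed
  then show ?thesis by simp
qed

text \<open>Here the difference of the two sides starts at \<open>0\<close> and has derivative
  \<open>z\<^sup>2 / (1 + z)\<close>.\<close>

lemma minus_ln_one_plus_le:
  fixes y :: real
  assumes "0 \<le> y"
  shows "y - ln (1 + y) \<le> y\<^sup>2 / 2"
proof -
  let ?h = "\<lambda>x::real. x\<^sup>2 / 2 - x + ln (1 + x)"
  have "?h 0 \<le> ?h y"
  proof (rule DERIV_nonneg_imp_nondecreasing[OF assms(1)])
    fix z :: real assume z: "0 \<le> z" "z \<le> y"
    then have "(?h has_real_derivative z\<^sup>2 / (1 + z)) (at z)"
      by (auto intro!: derivative_eq_intros simp: divide_simps power2_eq_square)
        (simp add: algebra_simps)
    with z show "\<exists>d. (?h has_real_derivative d) (at z) \<and> 0 \<le> d"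
      by (intro exI[of _ "z\<^sup>2 / (1 + z)"]) simp
  qed
  then show ?thesis by simp
qed


section \<open>Cumulant generating function of the centered difference\<close>

text \<open>Independence splits the exponential moment. The factor of \<open>Gm\<close> is evaluated
  at \<open>- t\<close> and is finite for every \<open>t\<close> in question, so \<open>Gp\<close>
  alone decides finiteness.\<close>

lemma (in prob_space) cgf_centered_gamma_diff:
  fixes Gp Gm :: "'a \<Rightarrow> real"
  assumes p: "ap > 0" "bp > 0" "am > 0" "bm > 0"
    and Dp: "distributed M lborel Gp (\<lambda>x. ennreal (gamma_density ap bp x))"
    and Dm: "distributed M lborel Gm (\<lambda>x. ennreal (gamma_density am bm x))"
    and ind: "indep_var borel Gp borel Gm"
    and t: "0 \<le> t"
  shows "cgf M (\<lambda>\<omega>. (Gp \<omega> - ap * bp) - (Gm \<omega> - am * bm)) t =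
    (if bp * t < 1
     then ereal (ap * (- ln (1 - bp * t) - bp * t) + am * (bm * t - ln (1 + bm * t))) else \<infinity>)"
proof -
  \<comment> \<open>\<open>C\<close> collects the deterministic factor produced by the
    centering.\<close>
  define C where "C = exp (t * (am * bm - ap * bp))"
  let ?m = "\<integral>\<^sup>+\<omega>. ennreal (exp (t * ((Gp \<omega> - ap * bp) - (Gm \<omega> - am * bm)))) \<partial>M"
  have [measurable]: "random_variable borel Gp" "random_variable borel Gm"
    using ind by (auto simp: indep_var_rv1 indep_var_rv2)
  have pos: "1 + bm * t > 0"
    using p t by (simp add: add_pos_nonneg)
  have Em: "(\<integral>\<^sup>+\<omega>. ennreal (exp (- t * Gm \<omega>)) \<partial>M) = ennreal ((1 + bm * t) powr (- am))"
    using nn_integral_exp_gamma[OF p(3,4) _ Dm, of "- t"] pos by simp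
  have "?m = (\<integral>\<^sup>+\<omega>. ennreal C * (ennreal (exp (t * Gp \<omega>)) * ennreal (exp (- t * Gm \<omega>))) \<partial>M)"
    by (auto intro!: nn_integral_cong arg_cong[of _ _ exp]
        simp: C_def ennreal_mult'[symmetric] exp_add[symmetric] algebra_simps)
  also have "\<dots> = ennreal C *
      (\<integral>\<^sup>+\<omega>. ennreal (exp (t * Gp \<omega>)) * ennreal (exp (- t * Gm \<omega>)) \<partial>M)"
    by (intro nn_integral_cmult) measurable
  also have "(\<integral>\<^sup>+\<omega>. ennreal (exp (t * Gp \<omega>)) * ennreal (exp (- t * Gm \<omega>)) \<partial>M)
      = (\<integral>\<^sup>+\<omega>. ennreal (exp (t * Gp \<omega>)) \<partial>M) * (\<integral>\<^sup>+\<omega>. ennreal (exp (- t * Gm \<omega>)) \<partial>M)"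
    by (rule indep_var_nn_integral,
        rule indep_var_compose[OF ind, unfolded comp_def]) measurable
  finally have m: "?m = ennreal C *
      ((\<integral>\<^sup>+\<omega>. ennreal (exp (t * Gp \<omega>)) \<partial>M) * ennreal ((1 + bm * t) powr (- am)))"
    unfolding Em .
  show ?thesis
  proof (cases "bp * t < 1")
    case True
    then have "?m = ennreal (C * ((1 - bp * t) powr (- ap) * (1 + bm * t) powr (- am)))"
      unfolding m nn_integral_exp_gamma[OF p(1,2) True Dp]
      by (simp add: ennreal_mult'[symmetric] C_def)
    moreover have "ln (C * ((1 - bp * t) powr (- ap) * (1 + bm * t) powr (- am)))
        = ap * (- ln (1 - bp * t) - bp * t) + am * (bm * t - ln (1 + bm * t))"
      using True pos by (simp add: C_def ln_mult ln_powr algebra_simps)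
    ultimately show ?thesis
      using True by (simp add: cgf_def C_def)
  next
    case False
    \<comment> \<open>The other two factors are strictly positive; this matters because
      \<open>0 * \<infinity> = 0\<close> in \<open>ennreal\<close>.\<close>
    then have "?m = \<infinity>"
      unfolding m using nn_integral_exp_gamma_eq_top[OF p(1,2) _ Dp, of t] pos
      by (simp add: C_def ennreal_mult_top ennreal_top_mult)
    with False show ?thesis by (simp add: cgf_def)
  qed
qed

section \<open>A criterion for boundary control\<close>

text \<open>The argument uses no feature of the Gamma law: blow-up of \<open>k\<close> at
  \<open>1 / b\<close> sends the reciprocal of the remainder's moment generating function to
  \<open>0\<close>, so \<open>Psi_plus\<close> approaches \<open>1 / t\<close> at
  \<open>t = 1 / b\<close>.\<close>

lemma boundary_controlled:
  fixes k :: "real \<Rightarrow> real"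
  assumes b: "b > 0" and V: "prob_space.variance M X = V" "V > 0"
    and fin: "\<And>t. 0 \<le> t \<Longrightarrow> b * t < 1 \<Longrightarrow> cgf M X t = ereal (k t)"
    and inf: "\<And>t. b * t \<ge> 1 \<Longrightarrow> cgf M X t = \<infinity>"
    and bound: "\<And>t. 0 \<le> t \<Longrightarrow> b * t < 1 \<Longrightarrow> k t \<le> V * t\<^sup>2 / (2 * (1 - b * t))"
    and lim: "filterlim k at_top (at_left (1 / b))"
  shows "c_plus M X = ereal b" "tau_plus M X = ereal (1 / b)"
    "(Psi_plus M X \<longlongrightarrow> ereal b) (at_left (1 / b))"
proof -
  \<comment> \<open>The product form treats \<open>c = 0\<close>, where \<open>1 / ereal c\<close>
    is infinite, together with \<open>c > 0\<close>.\<close>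
  have lt: "ereal t < 1 / ereal c \<longleftrightarrow> c * t < 1" if "0 \<le> c" for c t
    using that by (cases "c = 0") (auto simp: divide_ereal_def field_simps one_ereal_def)
  let ?S = "{c. 0 \<le> c \<and> (\<forall>t. 0 \<le> t \<and> ereal t < 1 / ereal c \<longrightarrow>
        cgf M X t \<le> ereal (prob_space.variance M X * t\<^sup>2 / (2 * (1 - c * t))))}"
  have "b \<in> ?S"
    using b fin bound V by (auto simp: lt)
  moreover have "b \<le> c" if "c \<in> ?S" for c
  \<comment> \<open>For \<open>c < b\<close> the point \<open>1 / b\<close> lies inside the range of
    the bound, whose right side is real there, whereas the cumulant generating function is
    infinite.\<close>
  proof (rule ccontr)
    assume "\<not> b \<le> c"
    then have "c * (1 / b) < 1" "0 \<le> c"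
      using b that by (auto simp: field_simps)
    then have "ereal (1 / b) < 1 / ereal c"
      using lt by simp
    with that b have "cgf M X (1 / b)
        \<le> ereal (prob_space.variance M X * (1 / b)\<^sup>2 / (2 * (1 - c * (1 / b))))"
      unfolding mem_Collect_eq by (meson divide_nonneg_pos zero_le_one)
    then have "cgf M X (1 / b) \<noteq> \<infinity>"
      by auto
    with inf[of "1 / b"] b show False by simp
  qed
  ultimately show "c_plus M X = ereal b"
    unfolding c_plus_def by (intro Inf_eqI) auto
  have "{t. 0 < t \<and> cgf M X t < \<infinity>} = {0<..<1 / b}"
  proof -
    have "cgf M X t < \<infinity> \<longleftrightarrow> b * t < 1" if "0 < t" for t
      using that fin[of t] inf[of t] by (cases "b * t < 1") auto
    then have "{t. 0 < t \<and> cgf M X t < \<infinity>} = {t. 0 < t \<and> b * t < 1}"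
      by blast
    also have "\<dots> = {0<..<1 / b}"
      using b by (auto simp: field_simps)
    finally show ?thesis .
  qed
  moreover have "ereal ` {0<..<1 / b} = {0<..<ereal (1 / b)}"
  proof (intro equalityI subsetI)
    fix x assume "x \<in> {0<..<ereal (1 / b)}"
    then show "x \<in> ereal ` {0<..<1 / b}" by (cases x) auto
  qed auto
  moreover have "Sup {0<..<ereal (1 / b)} = ereal (1 / b)"
    using b by (intro Sup_greaterThanLessThan) auto
  ultimately show "tau_plus M X = ereal (1 / b)"
    unfolding tau_plus_def using b by (simp add: sup_absorb2)
  have near: "\<forall>\<^sub>F t in at_left (1 / b). 0 < t \<and> t < 1 / b"
    using b by (intro eventually_at_leftI[of 0]) auto
  \<comment> \<open>Positivity keeps the \<open>ereal\<close> inverse in \<open>Psi_plus\<close>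
    away from \<open>0\<close>, where it would be \<open>\<infinity>\<close>, so it agrees with the
    real inverse.\<close>
  have "\<forall>\<^sub>F t in at_left (1 / b). k t > 0"
    using lim by (simp add: filterlim_at_top_dense)
  with near have "\<forall>\<^sub>F t in at_left (1 / b).
      ereal ((1 - V * t\<^sup>2 / 2 * inverse (k t)) / t) = Psi_plus M X t"
  proof eventually_elim
    case (elim t)
    then have "cgf M X t = ereal (k t)"
      using fin[of t] b by (simp add: field_simps)
    moreover have "2 * ereal (k t) = ereal (2 * k t)"
      by (simp flip: times_ereal.simps)
    ultimately show ?case
      using elim V by (simp add: Psi_plus_def remainder_mgf_def one_ereal_def field_simps)
  qed
  moreover have "((\<lambda>t. ereal ((1 - V * t\<^sup>2 / 2 * inverse (k t)) / t)) \<longlongrightarrow> ereal b) (at_left (1 / b))"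
  proof -
    have "((\<lambda>t. inverse (k t)) \<longlongrightarrow> 0) (at_left (1 / b))"
      by (rule tendsto_inverse_0_at_top[OF lim])
    then have "((\<lambda>t. (1 - V * t\<^sup>2 / 2 * inverse (k t)) / t)
        \<longlongrightarrow> (1 - V * (1 / b)\<^sup>2 / 2 * 0) / (1 / b)) (at_left (1 / b))"
      using b by (intro tendsto_intros) auto
    then show ?thesis by simp
  qed
  ultimately show "(Psi_plus M X \<longlongrightarrow> ereal b) (at_left (1 / b))"
    by (rule Lim_transform_eventually[rotated])
qed

section \<open>The right tail, and the left tail by reflection\<close>

lemma (in prob_space) centered_gamma_diff_boundary:
  fixes Gp Gm :: "'a \<Rightarrow> real"
  assumes p: "ap > 0" "bp > 0" "am > 0" "bm > 0"
    and Dp: "distributed M lborel Gp (\<lambda>x. ennreal (gamma_density ap bp x))"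
    and Dm: "distributed M lborel Gm (\<lambda>x. ennreal (gamma_density am bm x))"
    and ind: "indep_var borel Gp borel Gm"
  defines "X \<equiv> \<lambda>\<omega>. (Gp \<omega> - ap * bp) - (Gm \<omega> - am * bm)"
  shows "c_plus M X = ereal bp" "tau_plus M X = ereal (1 / bp)"
    "(Psi_plus M X \<longlongrightarrow> ereal bp) (at_left (1 / bp))"
proof -
  define V where "V = ap * bp\<^sup>2 + am * bm\<^sup>2"
  define k where
    "k t = ap * (- ln (1 - bp * t) - bp * t) + am * (bm * t - ln (1 + bm * t))" for t
  have var: "variance X = V"
    unfolding X_def V_def
    using variance_diff_indep_centered[OF
        indep_var_compose[OF ind, of "\<lambda>x. x - ap * bp" borel "\<lambda>x. x - am * bm" borel, unfolded comp_def]
        gamma_centered(1)[OF p(1,2) Dp] gamma_centered(1)[OF p(3,4) Dm]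
        gamma_centered(2)[OF p(1,2) Dp] gamma_centered(2)[OF p(3,4) Dm]
        gamma_centered(3)[OF p(1,2) Dp] gamma_centered(3)[OF p(3,4) Dm]]
    by (simp add: gamma_centered(4)[OF p(1,2) Dp] gamma_centered(4)[OF p(3,4) Dm])
  have V: "V > 0"
    using p by (simp add: V_def add_pos_pos)
  have fin: "cgf M X t = ereal (k t)" if "0 \<le> t" "bp * t < 1" for t
    using cgf_centered_gamma_diff[OF p Dp Dm ind] that by (simp add: X_def k_def)
  have inf: "cgf M X t = \<infinity>" if "bp * t \<ge> 1" for t
  proof -
    have "0 \<le> t"
      using that p(2) by (smt (verit) mult_pos_neg)
    with that show ?thesis
      using cgf_centered_gamma_diff[OF p Dp Dm ind] by (simp add: X_def)
  qed
  have bound: "k t \<le> V * t\<^sup>2 / (2 * (1 - bp * t))" if "0 \<le> t" "bp * t < 1" for t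
  proof -
    have "bm * t - ln (1 + bm * t) \<le> (bm * t)\<^sup>2 / 2"
      using that p by (intro minus_ln_one_plus_le) simp
    \<comment> \<open>Since \<open>0 < 1 - bp * t\<close> and \<open>1 - bp * t \<le> 1\<close>,
      dividing by it only weakens the bound. Both summands now share a denominator, and their
      numerators add up to \<open>V * t\<^sup>2\<close>.\<close>
    also have "\<dots> \<le> (bm * t)\<^sup>2 / (2 * (1 - bp * t))"
      using that p by (intro divide_left_mono) auto
    finally have "k t \<le> ap * ((bp * t)\<^sup>2 / (2 * (1 - bp * t))) + am * ((bm * t)\<^sup>2 / (2 * (1 - bp * t)))"
      unfolding k_def using that p
      by (intro add_mono mult_left_mono minus_ln_one_minus_le) auto
    also have "\<dots> = V * t\<^sup>2 / (2 * (1 - bp * t))"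
      by (simp add: V_def add_divide_distrib algebra_simps)
    finally show ?thesis .
  qed
  have "filterlim (\<lambda>t. 1 - bp * t) (at_right 0) (at_left (1 / bp))"
    unfolding filterlim_at
  proof
    show "\<forall>\<^sub>F t in at_left (1 / bp). 1 - bp * t \<in> {0<..} \<and> 1 - bp * t \<noteq> 0"
      using p by (intro eventually_at_leftI[of 0]) (auto simp: field_simps)
    have "((\<lambda>t. 1 - bp * t) \<longlongrightarrow> 1 - bp * (1 / bp)) (at_left (1 / bp))"
      by (intro tendsto_intros)
    then show "((\<lambda>t. 1 - bp * t) \<longlongrightarrow> 0) (at_left (1 / bp))"
      using p by simp
  qed
  then have "filterlim (\<lambda>t. ln (1 - bp * t)) at_bot (at_left (1 / bp))"
    by (rule filterlim_compose[OF ln_at_0])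
  then have top: "filterlim (\<lambda>t. ap * - ln (1 - bp * t)) at_top (at_left (1 / bp))"
    using p(1) by (intro filterlim_tendsto_pos_mult_at_top[OF tendsto_const])
      (auto simp: filterlim_uminus_at_bot)
  \<comment> \<open>All remaining terms of \<open>k\<close> are continuous at \<open>1 / bp\<close>,
    so the divergence comes from \<open>- ln (1 - bp * t)\<close> alone.\<close>
  have rest: "((\<lambda>t. am * (bm * t - ln (1 + bm * t)) - ap * (bp * t)) \<longlongrightarrow>
      am * (bm * (1 / bp) - ln (1 + bm * (1 / bp))) - ap * (bp * (1 / bp))) (at_left (1 / bp))"
    using p by (intro tendsto_intros) (auto simp: add_pos_pos divide_simps)
  have "filterlim k at_top (at_left (1 / bp))"
    using filterlim_tendsto_add_at_top[OF rest top] by (simp add: k_def[abs_def] algebra_simps)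
  from boundary_controlled[OF p(2) var V fin inf bound this]
  show "c_plus M X = ereal bp" "tau_plus M X = ereal (1 / bp)"
    "(Psi_plus M X \<longlongrightarrow> ereal bp) (at_left (1 / bp))"
    by auto
qed

text \<open>Reflection preserves the variance and moves the sign from \<open>t\<close> to
  \<open>X\<close> in the exponent. This links \<open>Psi_minus\<close>, defined through
  \<open>- t\<close>, with the right-tail result for \<open>- X\<close>.\<close>

lemma Psi_minus_eq_Psi_plus_uminus: "Psi_minus M X = Psi_plus M (\<lambda>\<omega>. - X \<omega>)"
proof -
  have "prob_space.variance M (\<lambda>\<omega>. - X \<omega>) = prob_space.variance M X"
    by (simp add: power2_commute)
  then show ?thesis
    by (simp add: Psi_minus_def Psi_plus_def remainder_mgf_def cgf_def fun_eq_iff)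
qed

theorem theorem5p2:
  fixes M :: "'a measure" and Gp Gm X :: "'a \<Rightarrow> real" and ap bp am bm :: real
  assumes "prob_space M"
    and "ap > 0" and "bp > 0" and "am > 0" and "bm > 0"
    and "distributed M lborel Gp (\<lambda>x. ennreal (gamma_density ap bp x))"
    and "distributed M lborel Gm (\<lambda>x. ennreal (gamma_density am bm x))"
    and "prob_space.indep_var M borel Gp borel Gm"
    and "X = (\<lambda>\<omega>. (Gp \<omega> - ap * bp) - (Gm \<omega> - am * bm))"
  shows "c_plus M X = ereal bp \<and> c_minus M X = ereal bm
    \<and> c_plus M X = 1 / tau_plus M X
    \<and> (Psi_plus M X \<longlongrightarrow> c_plus M X) (increasing_to (tau_plus M X))
    \<and> c_minus M X = 1 / tau_minus M X
    \<and> (Psi_minus M X \<longlongrightarrow> c_minus M X) (increasing_to (tau_minus M X))"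
proof -
  interpret prob_space M by fact
  note plus = centered_gamma_diff_boundary[OF assms(2-8), folded assms(9)]
  have uminus: "(\<lambda>\<omega>. (Gm \<omega> - am * bm) - (Gp \<omega> - ap * bp)) = (\<lambda>\<omega>. - X \<omega>)"
    by (simp add: assms(9))
  \<comment> \<open>The two parameter pairs and the two density hypotheses are swapped, which yields
    the right-tail result for \<open>- X\<close>.\<close>
  note minus = centered_gamma_diff_boundary[OF assms(4,5,2,3,7,6)
      indep_var_commute[OF assms(8)], unfolded uminus]
  show ?thesis
    using assms(3,5) plus minus
    by (simp add: c_minus_def tau_minus_def Psi_minus_eq_Psi_plus_uminus increasing_to_ereal
        one_ereal_def)
qed

end
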